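(* Let $a, b, c, d$ be rational numbers with $a(ad - bc) \neq 0$, and let $\mathcal C$ be the hyperbola $a\,x\,y + b\,x + c\,y + d = 0$. Say that $\{P_1, P_2, P_3\}$ is a rational distance set of three points $P_t = (x_t : y_t : 1)$ on $\mathcal C$. If we choose the point $$P_4 = \left( c + \frac{(a y_1 + b)(a y_2 + b)(a y_3 + b)}{ad - bc} \ : \ b + \frac{(a x_1 + c)(a x_2 + c)(a x_3 + c)}{ad - bc} \ : \ -a \right),$$ then $S = \{P_1, P_2, P_3, P_4\}$ is a rational distance set of four points on the hyperbola $\mathcal C$.
   Context: Homogeneous coordinates $(x:y:z)$ with $z \ne 0$ denote the affine point $(x/z, y/z)$. An affine point is rational if its affine coordinates are in $\mathbb Q$. The distance between affine points $P_s = (x_s : y_s : 1)$ and $P_t = (x_t : y_t : 1)$ is $\|P_s - P_t\| = \sqrt{(x_s - x_t)^2 + (y_s - y_t)^2}$. A rational distance set on $\mathcal C$ is a collection of affine rational points on $\mathcal C$ whose pairwise distances are rational numbers.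
   Formalization: The set S is shown to be a rational distance set on the hyperbola in all cases, but to consist of four points only when P_4 differs from P_1, P_2, P_3; it can coincide with one of them (e.g. xy = 4/3 with x-coordinates 1, 16/5, 5/9 gives P_4 = P_1). *)

theory Defs
  imports "HOL-Analysis.Analysis"
begin

text \<open>
  The affine point with homogeneous coordinates \<open>(X : Y : Z)\<close>; meaningful only for \<open>Z \<noteq> 0\<close>
  (division by zero would silently give the origin).
\<close>

definition affine_point :: "real \<Rightarrow> real \<Rightarrow> real \<Rightarrow> real \<times> real" where
  "affine_point X Y Z = (X / Z, Y / Z)"

definition rational_point :: "real \<times> real \<Rightarrow> bool" where
  "rational_point p \<longleftrightarrow> fst p \<in> \<rat> \<and> snd p \<in> \<rat>"

text \<open>
  Plane curves are represented by their sets of real affine points.  On \<^typ>\<open>real \<times> real\<close>,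
  \<^const>\<open>dist\<close> is the Euclidean distance.
\<close>

definition rational_distance_set :: "(real \<times> real) set \<Rightarrow> (real \<times> real) set \<Rightarrow> bool" where
  "rational_distance_set C S \<longleftrightarrow>
     S \<subseteq> C \<and> (\<forall>p\<in>S. rational_point p) \<and> (\<forall>p\<in>S. \<forall>q\<in>S. dist p q \<in> \<rat>)"

definition hyperbola :: "real \<Rightarrow> real \<Rightarrow> real \<Rightarrow> real \<Rightarrow> (real \<times> real) set" where
  "hyperbola a b c d = {(x, y). a * x * y + b * x + c * y + d = 0}"

end

theory Submission
  imports Defs
begin

text \<open>
  Put \<open>D = ad - bc\<close>.  In the coordinates \<open>u = ax + c\<close>, \<open>v = ay + b\<close> the curve is \<open>u v = -D\<close>, a
  rectangular hyperbola with asymptotes parallel to the axes, so the chord through the points with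
  parameters \<open>u\<close> and \<open>u'\<close> has slope \<open>D / (u u')\<close>.  The length of a chord of slope \<open>m\<close> is
  \<open>\<bar>x - x'\<bar> sqrt (1 + m\<^sup>2)\<close>, so for distinct rational points it is rational precisely when
  \<open>sqrt (1 + m\<^sup>2)\<close> is.

  Substituting \<open>v = -D / u\<close> into the equation of a circle gives a quartic in \<open>u\<close> with constant term
  \<open>D\<^sup>2\<close>.  The circle through \<open>P\<^sub>1\<close>, \<open>P\<^sub>2\<close>, \<open>P\<^sub>3\<close> therefore meets the hyperbola in a fourth point, counted
  with multiplicity, determined by \<open>u\<^sub>1 u\<^sub>2 u\<^sub>3 u\<^sub>4 = D\<^sup>2\<close>, and this point is \<open>P\<^sub>4\<close>.  The relation says
  that opposite chords, such as \<open>P\<^sub>1 P\<^sub>4\<close> and \<open>P\<^sub>2 P\<^sub>3\<close>, have reciprocal slopes (when \<open>P\<^sub>4\<close> coincides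
  with an endpoint, the chord is read as a tangent).
  Since \<open>sqrt (1 + 1 / m\<^sup>2) = sqrt (1 + m\<^sup>2) / \<bar>m\<bar>\<close>, rationality passes from
  each of the three given chords to the opposite one (\<open>opposite_chord_rational\<close>).
\<close>

lemma hyperbola_iff_shifted:
  assumes "a \<noteq> 0"
  shows "(x, y) \<in> hyperbola a b c d \<longleftrightarrow> (a * x + c) * (a * y + b) = - (a * d - b * c)"
proof -
  have "(a * x + c) * (a * y + b) + (a * d - b * c) = a * (a * x * y + b * x + c * y + d)"
    by (simp add: algebra_simps)
  with assms show ?thesis
    by (auto simp: hyperbola_def eq_neg_iff_add_eq_0)
qed

lemma hyperbola_shifted_nonzero:
  assumes "a * (a * d - b * c) \<noteq> 0" and "(x, y) \<in> hyperbola a b c d"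
  shows "a * x + c \<noteq> 0"
  using assms hyperbola_iff_shifted[of a x y b c d] by auto

lemma hyperbola_chord_slope:
  assumes "a * (a * d - b * c) \<noteq> 0"
    and P: "(x, y) \<in> hyperbola a b c d" and Q: "(x', y') \<in> hyperbola a b c d"
  shows "y - y' = (a * d - b * c) / ((a * x + c) * (a * x' + c)) * (x - x')"
proof -
  let ?u = "a * x + c" and ?u' = "a * x' + c" and ?v = "a * y + b" and ?v' = "a * y' + b"
  have a: "a \<noteq> 0" using assms(1) by auto
  have u: "?u \<noteq> 0" "?u' \<noteq> 0"
    using hyperbola_shifted_nonzero assms by blast+
  have uv: "?u * ?v = - (a * d - b * c)" "?u' * ?v' = - (a * d - b * c)"
    using P Q hyperbola_iff_shifted[OF a] by blast+
  have "a * (?u * ?u' * (y - y')) = ?u' * (?u * ?v) - ?u * (?u' * ?v')"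
    by (simp add: algebra_simps)
  also have "\<dots> = a * ((a * d - b * c) * (x - x'))"
    unfolding uv by (simp add: algebra_simps)
  finally have "?u * ?u' * (y - y') = (a * d - b * c) * (x - x')"
    using a by simp
  with u show ?thesis by (simp add: eq_divide_eq ac_simps)
qed

lemma dist_hyperbola_chord:
  assumes "a * (a * d - b * c) \<noteq> 0"
    and "(x, y) \<in> hyperbola a b c d" and "(x', y') \<in> hyperbola a b c d"
  shows "dist (x, y) (x', y') =
    \<bar>x - x'\<bar> * sqrt (1 + ((a * d - b * c) / ((a * x + c) * (a * x' + c)))\<^sup>2)"
    (is "_ = _ * sqrt (1 + ?m\<^sup>2)")
proof -
  have "dist (x, y) (x', y') = sqrt ((x - x')\<^sup>2 + (?m * (x - x'))\<^sup>2)"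
    unfolding dist_Pair_Pair dist_real_def power2_abs hyperbola_chord_slope[OF assms] ..
  also have "(x - x')\<^sup>2 + (?m * (x - x'))\<^sup>2 = (x - x')\<^sup>2 * (1 + ?m\<^sup>2)"
    unfolding power_mult_distrib by algebra
  finally show ?thesis by (simp add: real_sqrt_mult)
qed

lemma sqrt_one_plus_inverse_square:
  fixes m :: real
  assumes "m \<noteq> 0"
  shows "sqrt (1 + (1 / m)\<^sup>2) = sqrt (1 + m\<^sup>2) / \<bar>m\<bar>"
proof -
  have "1 + (1 / m)\<^sup>2 = (1 + m\<^sup>2) / m\<^sup>2"
    using assms by (simp add: field_simps)
  then show ?thesis by (simp add: real_sqrt_divide)
qed

text \<open>
  The product condition makes the slopes of \<open>P T\<close> and \<open>Q R\<close> reciprocal, so their lengths involve the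
  same square root up to a rational factor.  The chord \<open>Q R\<close> has to be nondegenerate for its length
  to determine that root.
\<close>

lemma opposite_chord_rational:
  assumes rat: "a \<in> \<rat>" "b \<in> \<rat>" "c \<in> \<rat>" "d \<in> \<rat>" and nondeg: "a * (a * d - b * c) \<noteq> 0"
    and P: "(x, y) \<in> hyperbola a b c d" "x \<in> \<rat>"
    and T: "(x', y') \<in> hyperbola a b c d" "x' \<in> \<rat>"
    and Q: "(s, t) \<in> hyperbola a b c d" "s \<in> \<rat>"
    and R: "(s', t') \<in> hyperbola a b c d" "s' \<in> \<rat>"
    and concyclic: "(a * x + c) * (a * x' + c) * ((a * s + c) * (a * s' + c)) = (a * d - b * c)\<^sup>2"
    and "(s, t) \<noteq> (s', t')" and QR: "dist (s, t) (s', t') \<in> \<rat>"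
  shows "dist (x, y) (x', y') \<in> \<rat>"
proof -
  define m where "m = (a * d - b * c) / ((a * s + c) * (a * s' + c))"
  have D: "a * d - b * c \<noteq> 0" using nondeg by auto
  have nz: "a * s + c \<noteq> 0" "a * s' + c \<noteq> 0" "a * x + c \<noteq> 0" "a * x' + c \<noteq> 0"
    using hyperbola_shifted_nonzero[OF nondeg] P T Q R by blast+
  have m: "m \<noteq> 0" using D nz by (simp add: m_def)
  have m_rat: "m \<in> \<rat>" unfolding m_def using rat Q R by simp
  have dQR: "dist (s, t) (s', t') = \<bar>s - s'\<bar> * sqrt (1 + m\<^sup>2)"
    unfolding m_def by (rule dist_hyperbola_chord[OF nondeg Q(1) R(1)])
  have "s \<noteq> s'" using dQR \<open>(s, t) \<noteq> (s', t')\<close> by force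
  then have "sqrt (1 + m\<^sup>2) = dist (s, t) (s', t') / \<bar>s - s'\<bar>"
    using dQR by simp
  then have root_rat: "sqrt (1 + m\<^sup>2) \<in> \<rat>" using QR Q R by simp
  have "(a * d - b * c) / ((a * x + c) * (a * x' + c)) = 1 / m"
    unfolding m_def using concyclic D nz by (simp add: frac_eq_eq power2_eq_square ac_simps)
  then have "dist (x, y) (x', y') = \<bar>x - x'\<bar> * (sqrt (1 + m\<^sup>2) / \<bar>m\<bar>)"
    using dist_hyperbola_chord[OF nondeg P(1) T(1)] sqrt_one_plus_inverse_square[OF m] by simp
  then show ?thesis using root_rat m_rat P T by simp
qed

theorem corollary2:
  fixes a b c d x1 y1 x2 y2 x3 y3 :: real and P1 P2 P3 P4 :: "real \<times> real"
  assumes "a \<in> \<rat>" "b \<in> \<rat>" "c \<in> \<rat>" "d \<in> \<rat>"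
    and "a * (a * d - b * c) \<noteq> 0"
    and "P1 = affine_point x1 y1 1" "P2 = affine_point x2 y2 1" "P3 = affine_point x3 y3 1"
    and "card {P1, P2, P3} = 3"
    and "rational_distance_set (hyperbola a b c d) {P1, P2, P3}"
    and "P4 = affine_point
           (c + (a * y1 + b) * (a * y2 + b) * (a * y3 + b) / (a * d - b * c))
           (b + (a * x1 + c) * (a * x2 + c) * (a * x3 + c) / (a * d - b * c))
           (- a)"
  shows "rational_distance_set (hyperbola a b c d) {P1, P2, P3, P4} \<and>
         (P4 \<notin> {P1, P2, P3} \<longrightarrow> card {P1, P2, P3, P4} = 4)"
proof -
  define D where "D = a * d - b * c"
  define u1 u2 u3 where "u1 = a * x1 + c" and "u2 = a * x2 + c" and "u3 = a * x3 + c"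
  define v1 v2 v3 where "v1 = a * y1 + b" and "v2 = a * y2 + b" and "v3 = a * y3 + b"
  define x4 y4 where "x4 = (c + v1 * v2 * v3 / D) / (- a)" and "y4 = (b + u1 * u2 * u3 / D) / (- a)"
  note uv_defs = u1_def u2_def u3_def v1_def v2_def v3_def
  have a: "a \<noteq> 0" and D: "D \<noteq> 0" using assms(5) by (auto simp: D_def)
  have pts: "P1 = (x1, y1)" "P2 = (x2, y2)" "P3 = (x3, y3)"
    using assms(6-8) by (simp_all add: affine_point_def)
  have P4: "P4 = (x4, y4)"
    unfolding assms(11) affine_point_def x4_def y4_def uv_defs D_def by simp
  have distinct: "P1 \<noteq> P2" "P1 \<noteq> P3" "P2 \<noteq> P3"
    using assms(9) by (auto simp: card_insert_if split: if_splits)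
  have on: "(x1, y1) \<in> hyperbola a b c d" "(x2, y2) \<in> hyperbola a b c d"
      "(x3, y3) \<in> hyperbola a b c d"
    and coord_rat: "x1 \<in> \<rat>" "y1 \<in> \<rat>" "x2 \<in> \<rat>" "y2 \<in> \<rat>" "x3 \<in> \<rat>" "y3 \<in> \<rat>"
    and dist_rat: "dist (x1, y1) (x2, y2) \<in> \<rat>" "dist (x1, y1) (x3, y3) \<in> \<rat>"
      "dist (x2, y2) (x3, y3) \<in> \<rat>"
    using assms(10) by (auto simp: rational_distance_set_def rational_point_def pts)
  have uv: "u1 * v1 = - D" "u2 * v2 = - D" "u3 * v3 = - D"
    using on hyperbola_iff_shifted[OF a] unfolding uv_defs D_def by blast+
  have uv_rat: "u1 \<in> \<rat>" "u2 \<in> \<rat>" "u3 \<in> \<rat>" "v1 \<in> \<rat>" "v2 \<in> \<rat>" "v3 \<in> \<rat>" "D \<in> \<rat>"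
    using assms(1-4) coord_rat by (simp_all add: uv_defs D_def)
  then have P4_rat: "x4 \<in> \<rat>" "y4 \<in> \<rat>"
    using assms(1-3) by (simp_all add: x4_def y4_def)
  have u4: "a * x4 + c = - (v1 * v2 * v3) / D" and v4: "a * y4 + b = - (u1 * u2 * u3) / D"
    using a by (simp_all add: x4_def y4_def)
  have "(u1 * v1) * (u2 * v2) * (u3 * v3) = - (D ^ 3)"
    unfolding uv by (simp add: power3_eq_cube)
  then have prod: "u1 * u2 * u3 * (v1 * v2 * v3) = - (D ^ 3)" by (simp add: ac_simps)
  have "(a * x4 + c) * (a * y4 + b) = u1 * u2 * u3 * (v1 * v2 * v3) / D\<^sup>2"
    unfolding u4 v4 by (simp add: power2_eq_square ac_simps)
  then have "(a * x4 + c) * (a * y4 + b) = - D"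
    using prod D by (simp add: power2_eq_square power3_eq_cube)
  then have on4: "(x4, y4) \<in> hyperbola a b c d"
    using hyperbola_iff_shifted[OF a] by (simp add: D_def)
  have "u1 * u2 * u3 * (a * x4 + c) = - (u1 * u2 * u3 * (v1 * v2 * v3)) / D"
    unfolding u4 by simp
  then have concyclic: "u1 * u2 * u3 * (a * x4 + c) = D\<^sup>2"
    using prod D by (simp add: power2_eq_square power3_eq_cube)
  have "dist (x1, y1) (x4, y4) \<in> \<rat>"
    by (rule opposite_chord_rational[where s = x2 and t = y2 and s' = x3 and t' = y3])
      (use assms(1-5) on on4 coord_rat P4_rat dist_rat distinct concyclic in
        \<open>simp_all add: pts uv_defs D_def ac_simps\<close>)
  moreover have "dist (x2, y2) (x4, y4) \<in> \<rat>"
    by (rule opposite_chord_rational[where s = x1 and t = y1 and s' = x3 and t' = y3])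
      (use assms(1-5) on on4 coord_rat P4_rat dist_rat distinct concyclic in
        \<open>simp_all add: pts uv_defs D_def ac_simps\<close>)
  moreover have "dist (x3, y3) (x4, y4) \<in> \<rat>"
    by (rule opposite_chord_rational[where s = x1 and t = y1 and s' = x2 and t' = y2])
      (use assms(1-5) on on4 coord_rat P4_rat dist_rat distinct concyclic in
        \<open>simp_all add: pts uv_defs D_def ac_simps\<close>)
  ultimately have "rational_distance_set (hyperbola a b c d) {P1, P2, P3, P4}"
    using on on4 coord_rat P4_rat dist_rat
    by (simp add: rational_distance_set_def rational_point_def pts P4 dist_commute)
  moreover have "card {P1, P2, P3, P4} = 4" if "P4 \<notin> {P1, P2, P3}"
    using that distinct by auto
  ultimately show ?thesis by blast
qed

end
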